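(* There are exactly $2$ pairwise non-isomorphic $(K_4-e)$-designs of order $11$.
   Context: $K_4-e$ is the graph on four vertices $a,b,c,d$ with edges $ab,ac,ad,bc,bd$; it is denoted $[a,b,c-d]$. A $(K_4-e)$-design of order $v$ is a pair $(X,\mathcal B)$ where $X$ is a set of $v$ vertices and $\mathcal B$ is a collection of copies of $K_4-e$ (called blocks) with vertices in $X$ whose edge sets partition the edge set of the complete graph $K_v$ on $X$. Two $(K_4-e)$-designs $(X,\mathcal B_1)$ and $(X,\mathcal B_2)$ are isomorphic if there is a permutation $\pi$ of $X$ with $\pi(\mathcal B_1)=\mathcal B_2$, where $\pi$ is applied to the vertices of each block. *)

theory Defs
  imports Main
begin

text \<open>Edges are 2-element sets of vertices. The block [a,b,c-d] is the copy of K4-e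
  on vertices a,b,c,d with edges ab, ac, ad, bc, bd; a block is represented by its edge set
  (so that [a,b,c-d], [b,a,c-d], [a,b,d-c], [b,a,d-c] denote the same block).\<close>

definition kfe_edges :: "'a \<Rightarrow> 'a \<Rightarrow> 'a \<Rightarrow> 'a \<Rightarrow> 'a set set" where
  "kfe_edges a b c d = {{a,b},{a,c},{a,d},{b,c},{b,d}}"

definition kfe_block :: "'a set \<Rightarrow> 'a set set \<Rightarrow> bool" where
  "kfe_block X E \<longleftrightarrow> (\<exists>a b c d. distinct [a,b,c,d] \<and> {a,b,c,d} \<subseteq> X \<and> E = kfe_edges a b c d)"

definition kfe_design :: "'a set \<Rightarrow> 'a set set set \<Rightarrow> bool" where
  "kfe_design X \<B> \<longleftrightarrow> (\<forall>E\<in>\<B>. kfe_block X E) \<and>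
     (\<forall>x\<in>X. \<forall>y\<in>X. x \<noteq> y \<longrightarrow> (\<exists>!E. E \<in> \<B> \<and> {x,y} \<in> E))"

definition kfe_iso :: "'a set \<Rightarrow> 'a set set set \<Rightarrow> 'a set set set \<Rightarrow> bool" where
  "kfe_iso X \<B>1 \<B>2 \<longleftrightarrow> (\<exists>\<pi>. bij_betw \<pi> X X \<and> (\<lambda>E. (\<lambda>e. \<pi> ` e) ` E) ` \<B>1 = \<B>2)"

end

theory Submission
  imports Defs
begin

text \<open>
  In a block [a,b,c-d] call {a,b} the spine and c, d the tails. A vertex lying on p spines and being
  a tail q times satisfies 3p + 2q = 10, and counting gives p = q = 2 for every vertex, so the 11
  spines form a 2-regular graph. Direct each edge that is not a spine from its tail to its end on
  the spine: this orients all pairs that are not spines, and the out-neighbourhood of each vertex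
  is the union of two disjoint spines. Hence a union of spine cycles with n vertices satisfies
  4 | n(n-3), and n = 4 is impossible; the spines form an 11-cycle or an 8-cycle and a triangle.
  A small backtracking search excludes the latter, and for the former it leaves four
  rotation-invariant solutions, two designs and their mirror images.
\<close>

section \<open>Spines and tails\<close>

text \<open>A block is given only as an edge set, so spine and tails must be read off from its
  edges; defined that way they are carried along by every isomorphism, and an invariant can be
  phrased with them. Passing from a design to its oriented pairs loses nothing: knowing for each
  vertex y the spines of which it is a tail means knowing the tails of each spine, and spine and
  tails fix the block. This reduces the classification to choosing two disjoint spines for each
  vertex. The search assumes no symmetry; that its results are invariant under rotation is an
  outcome. A solution is named by two offsets a, b: vertex y is a tail of the spines {y+a, y+a+1}
  and {y+b, y+b+1} modulo 11. Reflecting the cycle changes an offset c into 10 - c, which pairs the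
  offsets 2, 4 with 6, 8 and the offsets 2, 6 with 4, 8.\<close>

definition spine :: "'a set set \<Rightarrow> 'a set" where
  "spine E = \<Union>{e \<in> E. \<forall>f\<in>E. e \<inter> f \<noteq> {}}"

definition tail :: "'a set set \<Rightarrow> 'a set" where
  "tail E = \<Union>E - spine E"

text \<open>Only ab meets all five edges, since ac is disjoint from bd and ad from bc.\<close>

lemma spine_kfe_edges: "distinct [a,b,c,d] \<Longrightarrow> spine (kfe_edges a b c d) = {a,b}"
proof -
  assume "distinct [a,b,c,d]"
  then have "{e \<in> kfe_edges a b c d. \<forall>f\<in>kfe_edges a b c d. e \<inter> f \<noteq> {}} = {{a,b}}"
    unfolding kfe_edges_def by auto
  then show ?thesis by (simp add: spine_def)
qed

lemma tail_kfe_edges: "distinct [a,b,c,d] \<Longrightarrow> tail (kfe_edges a b c d) = {c,d}"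
  by (auto simp: tail_def spine_kfe_edges) (auto simp: kfe_edges_def)

lemma mem_kfe_edges_iff:
  assumes "distinct [a,b,c,d]" "x \<noteq> y"
  shows "{x,y} \<in> kfe_edges a b c d \<longleftrightarrow>
    x \<in> {a,b} \<and> y \<in> {a,b} \<or> x \<in> {a,b} \<and> y \<in> {c,d} \<or> x \<in> {c,d} \<and> y \<in> {a,b}"
  using assms by (auto simp: kfe_edges_def doubleton_eq_iff)

lemma kfe_edges_swap: "kfe_edges b a c d = kfe_edges a b c d" "kfe_edges a b d c = kfe_edges a b c d"
  by (auto simp: kfe_edges_def insert_commute)

lemma kfe_blockE:
  assumes "kfe_block X E"
  obtains a b c d where "distinct [a,b,c,d]" "{a,b,c,d} \<subseteq> X" "E = kfe_edges a b c d"
    "spine E = {a,b}" "tail E = {c,d}"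
proof -
  obtain a b c d where *: "distinct [a,b,c,d]" "{a,b,c,d} \<subseteq> X" "E = kfe_edges a b c d"
    using assms unfolding kfe_block_def by blast
  then show thesis using that spine_kfe_edges[OF *(1)] tail_kfe_edges[OF *(1)] by blast
qed

lemma kfe_edges_cong:
  assumes "{a,b} = {a',b'}" "{c,d} = {c',d'}"
  shows "kfe_edges a b c d = kfe_edges a' b' c' d'"
  using assms unfolding doubleton_eq_iff by (elim disjE conjE; simp only: kfe_edges_swap)

lemma sum_of_bool_card: "finite A \<Longrightarrow> (\<Sum>x\<in>A. of_bool (P x)) = card {x \<in> A. P x}"
  by (simp add: of_bool_def sum.If_cases Int_def)

section \<open>Degrees in a design of order 11\<close>

context
  fixes X :: "'a set" and B :: "'a set set set"
  assumes fin: "finite X" and card_X: "card X = 11" and des: "kfe_design X B"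
begin

lemma block_of_design: "E \<in> B \<Longrightarrow> kfe_block X E" and unique_block: "x \<in> X \<Longrightarrow> y \<in> X \<Longrightarrow> x \<noteq> y \<Longrightarrow> \<exists>!E. E \<in> B \<and> {x,y} \<in> E"
  using des unfolding kfe_design_def by auto

lemma same_block: "E \<in> B \<Longrightarrow> F \<in> B \<Longrightarrow> x \<noteq> y \<Longrightarrow> {x,y} \<in> E \<Longrightarrow> {x,y} \<in> F \<Longrightarrow> x \<in> X \<Longrightarrow> y \<in> X \<Longrightarrow> E = F"
  using unique_block by blast

lemma edge_iff:
  assumes "E \<in> B" "x \<noteq> y"
  shows "{x,y} \<in> E \<longleftrightarrow> x \<in> spine E \<and> y \<in> spine E \<or> x \<in> spine E \<and> y \<in> tail E \<or> x \<in> tail E \<and> y \<in> spine E"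
proof -
  from block_of_design[OF assms(1)] obtain a b c d where *: "distinct [a,b,c,d]" "{a,b,c,d} \<subseteq> X" "E = kfe_edges a b c d"
    "spine E = {a,b}" "tail E = {c,d}" by (rule kfe_blockE)
  show ?thesis using mem_kfe_edges_iff[OF *(1) assms(2)] * by simp
qed

lemma spine_tail: assumes "E \<in> B" shows "card (spine E) = 2" "card (tail E) = 2" "spine E \<inter> tail E = {}"
  "spine E \<subseteq> X" "tail E \<subseteq> X"
proof -
  from block_of_design[OF assms(1)] obtain a b c d where *: "distinct [a,b,c,d]" "{a,b,c,d} \<subseteq> X" "E = kfe_edges a b c d"
    "spine E = {a,b}" "tail E = {c,d}" by (rule kfe_blockE)
  then show "card (spine E) = 2" "card (tail E) = 2" "spine E \<inter> tail E = {}"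
  "spine E \<subseteq> X" "tail E \<subseteq> X" by auto
qed

lemma finite_B: "finite B"
proof (rule finite_subset)
  show "B \<subseteq> Pow (Pow X)"
  proof
    fix E assume "E \<in> B"
    from block_of_design[OF this] show "E \<in> Pow (Pow X)"
      by (rule kfe_blockE) (auto simp: kfe_edges_def)
  qed
  show "finite (Pow (Pow X))" using fin by simp
qed

lemma card_nbrs_in_block:
  assumes "E \<in> B"
  shows "card {y \<in> X. y \<noteq> x \<and> {x,y} \<in> E} = 3 * of_bool (x \<in> spine E) + 2 * of_bool (x \<in> tail E)"
proof -
  note st = spine_tail[OF assms]
  have f: "finite (spine E)" "finite (tail E)" using st by (auto intro: finite_subset[OF _ fin])
  have "{y \<in> X. y \<noteq> x \<and> {x,y} \<in> E} = {y \<in> X. y \<noteq> x \<and>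
      (x \<in> spine E \<and> y \<in> spine E \<or> x \<in> spine E \<and> y \<in> tail E \<or> x \<in> tail E \<and> y \<in> spine E)}"
    using edge_iff[OF assms] by (intro Collect_cong conj_cong refl) auto
  also have "\<dots> =
    (if x \<in> spine E then (spine E - {x}) \<union> tail E else if x \<in> tail E then spine E else {})"
    using st by auto
  finally have "{y \<in> X. y \<noteq> x \<and> {x,y} \<in> E} =
    (if x \<in> spine E then (spine E - {x}) \<union> tail E else if x \<in> tail E then spine E else {})" .
  moreover have "x \<in> spine E \<Longrightarrow> card ((spine E - {x}) \<union> tail E) = 3"
    using st f by (subst card_Un_disjoint) auto
  ultimately show ?thesis using st by auto
qed

definition "spine_deg x = card {E \<in> B. x \<in> spine E}"
definition "tail_deg x = card {E \<in> B. x \<in> tail E}"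

text \<open>The blocks partition the ten pairs at \<open>x\<close>; a block takes three of them if
  \<open>x\<close> is on its spine and two if \<open>x\<close> is one of its tails.\<close>

lemma degree_eq:
  assumes "x \<in> X" shows "3 * spine_deg x + 2 * tail_deg x = 10"
proof -
  have eq: "X - {x} = (\<Union>E\<in>B. {y \<in> X. y \<noteq> x \<and> {x,y} \<in> E})" using unique_block[OF assms] by blast
  have "card (X - {x}) = 10" using card_Diff_singleton[OF assms] card_X by simp
  from this[symmetric, unfolded eq] have "10 = card (\<Union>E\<in>B. {y \<in> X. y \<noteq> x \<and> {x,y} \<in> E})" .
  also have "\<dots> = (\<Sum>E\<in>B. card {y \<in> X. y \<noteq> x \<and> {x,y} \<in> E})"
  proof (rule card_UN_disjoint)
    have "{y \<in> X. y \<noteq> x \<and> {x,y} \<in> E} \<inter> {y \<in> X. y \<noteq> x \<and> {x,y} \<in> F} = {}"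
      if "E \<in> B" "F \<in> B" "E \<noteq> F" for E F
    proof (rule equals0I)
      fix y assume "y \<in> {y \<in> X. y \<noteq> x \<and> {x,y} \<in> E} \<inter> {y \<in> X. y \<noteq> x \<and> {x,y} \<in> F}"
      then have "y \<in> X" "x \<noteq> y" "{x,y} \<in> E" "{x,y} \<in> F" by auto
      then show False using same_block[OF that(1,2)] that(3) assms by blast
    qed
    then show "\<forall>E\<in>B. \<forall>F\<in>B. E \<noteq> F \<longrightarrow>
        {y \<in> X. y \<noteq> x \<and> {x,y} \<in> E} \<inter> {y \<in> X. y \<noteq> x \<and> {x,y} \<in> F} = {}" by simp
  qed (simp_all add: finite_B fin)
  also have "\<dots> = (\<Sum>E\<in>B. 3 * of_bool (x \<in> spine E) + 2 * of_bool (x \<in> tail E))"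
    by (rule sum.cong) (auto simp: card_nbrs_in_block)
  also have "\<dots> = 3 * spine_deg x + 2 * tail_deg x"
    by (simp only: sum.distrib sum_distrib_left[symmetric] sum_of_bool_card[OF finite_B] spine_deg_def tail_deg_def)
  finally show ?thesis by simp
qed

lemma sum_degs: "(\<Sum>x\<in>X. spine_deg x) = 2 * card B" "(\<Sum>x\<in>X. tail_deg x) = 2 * card B"
proof -
  have "(\<Sum>x\<in>X. card {E \<in> B. x \<in> s E}) = 2 * card B" if s: "\<And>E. E \<in> B \<Longrightarrow> s E \<subseteq> X \<and> card (s E) = 2" for s
  proof -
    have "(\<Sum>x\<in>X. card {E \<in> B. x \<in> s E}) = (\<Sum>x\<in>X. \<Sum>E\<in>B. of_bool (x \<in> s E))"
      by (simp only: sum_of_bool_card[OF finite_B])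
    also have "\<dots> = (\<Sum>E\<in>B. \<Sum>x\<in>X. of_bool (x \<in> s E))" by (rule sum.swap)
    also have "\<dots> = (\<Sum>E\<in>B. 2)"
    proof (rule sum.cong)
      fix E assume "E \<in> B"
      with s have "{x \<in> X. x \<in> s E} = s E" "card (s E) = 2" by auto
      then show "(\<Sum>x\<in>X. of_bool (x \<in> s E)) = (2::nat)" by (simp only: sum_of_bool_card[OF fin])
    qed simp
    finally show ?thesis by simp
  qed
  from this[of spine] this[of tail] show "(\<Sum>x\<in>X. spine_deg x) = 2 * card B" "(\<Sum>x\<in>X. tail_deg x) = 2 * card B"
    using spine_tail by (auto simp: spine_deg_def tail_deg_def)
qed

text \<open>Summing \<open>degree_eq\<close> over the 11 vertices gives
  \<open>10 * card B = 110\<close>, so the spine degrees sum to 22. The equation also makes each of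
  them even, hence at most 2, and so all are equal to 2.\<close>

lemma degs: assumes "x \<in> X" shows "spine_deg x = 2" "tail_deg x = 2"
proof -
  have "3 * (\<Sum>x\<in>X. spine_deg x) + 2 * (\<Sum>x\<in>X. tail_deg x) = (\<Sum>x\<in>X. 10)"
    by (simp only: sum_distrib_left sum.distrib[symmetric]) (rule sum.cong, simp_all add: degree_eq)
  then have "card B = 11" using sum_degs card_X by simp
  then have "(\<Sum>x\<in>X. spine_deg x) = (\<Sum>x\<in>X. 2)" using sum_degs card_X by simp
  moreover have le: "spine_deg y \<le> 2" if "y \<in> X" for y using degree_eq[OF that] by presburger
  ultimately show "spine_deg x = 2" using sum_mono_inv[of spine_deg X "\<lambda>_. 2" x] assms fin by auto
  then show "tail_deg x = 2" using degree_eq[OF assms] by simp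
qed

section \<open>The graph of spines and the orientation of the other pairs\<close>

definition "nbrs x = {y. y \<noteq> x \<and> {x,y} \<in> spine ` B}"
definition "tailed y = spine ` {E \<in> B. y \<in> tail E}"

lemma spine_pair: assumes "E \<in> B" "x \<in> spine E" obtains y where "spine E = {x,y}" "y \<noteq> x" "y \<in> X" "{x,y} \<in> E"
proof -
  from spine_tail(1)[OF assms(1)] assms(2) obtain y where "spine E = {x,y}" "y \<noteq> x"
    unfolding card_2_iff by (metis insertE insert_commute singletonD)
  then show ?thesis using that[of y] spine_tail[OF assms(1)] edge_iff[OF assms(1), of x y] by auto
qed

text \<open>The spine is itself an edge of its block, and an edge lies in one block only.\<close>

lemma inj_spine: "inj_on spine B"
proof (rule inj_onI)
  fix E F assume EF: "E \<in> B" "F \<in> B" "spine E = spine F"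
  from spine_tail(1)[OF EF(1)] obtain x y where xy: "spine E = {x,y}" "x \<noteq> y" by (auto simp: card_2_iff)
  then have "{x,y} \<in> E" "{x,y} \<in> F" using EF edge_iff by auto
  moreover have "x \<in> X" "y \<in> X" using spine_tail(4)[OF EF(1)] xy by auto
  ultimately show "E = F" using same_block[OF EF(1,2) xy(2)] by blast
qed

lemma card_nbrs: assumes "x \<in> X" shows "card (nbrs x) = 2"
proof -
  have "(\<lambda>y. {x,y}) ` nbrs x = spine ` {E \<in> B. x \<in> spine E}"
  proof
    show "(\<lambda>y. {x,y}) ` nbrs x \<subseteq> spine ` {E \<in> B. x \<in> spine E}" by (auto simp: nbrs_def)
    show "spine ` {E \<in> B. x \<in> spine E} \<subseteq> (\<lambda>y. {x,y}) ` nbrs x"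
    proof
      fix e assume "e \<in> spine ` {E \<in> B. x \<in> spine E}"
      then obtain E where E: "E \<in> B" "x \<in> spine E" "e = spine E" by auto
      obtain y where "spine E = {x,y}" "y \<noteq> x" using spine_pair[OF E(1,2)] by metis
      then have "y \<in> nbrs x" using E unfolding nbrs_def by (metis (mono_tags, lifting) CollectI image_eqI)
      then show "e \<in> (\<lambda>y. {x,y}) ` nbrs x" using E \<open>spine E = {x,y}\<close> by auto
    qed
  qed
  moreover have "card (spine ` {E \<in> B. x \<in> spine E}) = 2"
    using degs(1)[OF assms] inj_spine unfolding spine_deg_def
    by (subst card_image) (auto intro: inj_on_subset)
  moreover have "card ((\<lambda>y. {x,y}) ` nbrs x) = card (nbrs x)"
    by (rule card_image) (auto simp: inj_on_def doubleton_eq_iff)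
  ultimately show ?thesis by simp
qed

lemma nbrs_iff: "x \<noteq> y \<Longrightarrow> y \<in> nbrs x \<longleftrightarrow> (\<exists>E\<in>B. spine E = {x,y})"
  by (auto simp: nbrs_def)

lemma nbrs_basic: "x \<notin> nbrs x" "nbrs x \<subseteq> X" "y \<in> nbrs x \<Longrightarrow> x \<in> nbrs y"
  using spine_tail(4) by (auto simp: nbrs_def insert_commute)

text \<open>Otherwise a pair of \<open>y\<close> and a spine end of \<open>E\<close> would lie both
  in \<open>E\<close> and in the block having this pair as spine, although \<open>y\<close> is a
  tail of \<open>E\<close>.\<close>

lemma spine_of_tail:
  assumes "E \<in> B" "y \<in> tail E" shows "spine E \<subseteq> X - insert y (nbrs y)"
proof
  fix a assume a: "a \<in> spine E"
  then have "a \<noteq> y" "a \<in> X" "y \<in> X" using assms spine_tail[OF assms(1)] by auto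
  moreover have "a \<notin> nbrs y"
  proof
    assume "a \<in> nbrs y"
    then obtain F where F: "F \<in> B" "spine F = {y,a}" by (auto simp: nbrs_def)
    then have "{a,y} \<in> F" "{a,y} \<in> E" using edge_iff[of _ a y] assms a \<open>a \<noteq> y\<close> by auto
    then have "E = F" using same_block assms F \<open>a \<noteq> y\<close> \<open>a \<in> X\<close> \<open>y \<in> X\<close> by blast
    then show False using F assms spine_tail(3)[OF assms(1)] by auto
  qed
  ultimately show "a \<in> X - insert y (nbrs y)" by simp
qed

text \<open>If the spines of the two blocks with tail \<open>y\<close> met in z, both blocks would
  contain the pair {z,y}.\<close>

lemma tailed_shape:
  assumes "y \<in> X"
  shows "\<exists>a b c d. distinct [a,b,c,d] \<and> {a,b,c,d} \<subseteq> X - insert y (nbrs y) \<and> b \<in> nbrs a \<and> d \<in> nbrs c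
    \<and> tailed y = {{a,b},{c,d}}"
proof -
  from degs(2)[OF assms] obtain E F where EF: "{E \<in> B. y \<in> tail E} = {E,F}" "E \<noteq> F"
    unfolding tail_deg_def by (auto simp: card_2_iff)
  then have E: "E \<in> B" "y \<in> tail E" and F: "F \<in> B" "y \<in> tail F" by auto
  obtain a b where ab: "spine E = {a,b}" "a \<noteq> b" using spine_tail(1)[OF E(1)] by (auto simp: card_2_iff)
  obtain c d where cd: "spine F = {c,d}" "c \<noteq> d" using spine_tail(1)[OF F(1)] by (auto simp: card_2_iff)
  have "spine E \<inter> spine F = {}"
  proof (rule ccontr)
    assume "spine E \<inter> spine F \<noteq> {}"
    then obtain z where z: "z \<in> spine E" "z \<in> spine F" by auto
    then have "{z,y} \<in> E" "{z,y} \<in> F" "z \<noteq> y" "z \<in> X" using edge_iff[of _ z y] E F spine_tail[OF E(1)] by auto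
    then show False using same_block E F assms EF by blast
  qed
  then have "distinct [a,b,c,d]" using ab cd by auto
  moreover have "{a,b,c,d} \<subseteq> X - insert y (nbrs y)" using spine_of_tail[OF E] spine_of_tail[OF F] ab cd by auto
  moreover have "b \<in> nbrs a" "d \<in> nbrs c" using E F ab cd nbrs_iff by metis+
  moreover have "tailed y = {{a,b},{c,d}}" using EF ab cd by (simp add: tailed_def)
  ultimately show ?thesis by blast
qed

text \<open>The pair is not the spine of the block containing it, so there one vertex is a spine end
  and the other a tail; no other block can contribute.\<close>

lemma tailed_tournament:
  assumes "x \<in> X" "y \<in> X" "x \<noteq> y" "y \<notin> nbrs x"
  shows "(x \<in> \<Union>(tailed y)) \<noteq> (y \<in> \<Union>(tailed x))"
proof -
  obtain E where E: "E \<in> B" "{x,y} \<in> E" using unique_block assms by blast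
  have *: "F = E" if "F \<in> B" "u \<in> spine F" "v \<in> tail F" "{u,v} = {x,y}" for F u v
  proof -
    have "u \<noteq> v" using spine_tail(3)[OF that(1)] that by auto
    then have "{x,y} \<in> F" using edge_iff[OF that(1), of u v] that by auto
    then show ?thesis using same_block E assms that by blast
  qed
  have "x \<in> \<Union>(tailed y) \<longleftrightarrow> x \<in> spine E \<and> y \<in> tail E"
    using *[of _ x y] E by (auto simp: tailed_def)
  moreover have "y \<in> \<Union>(tailed x) \<longleftrightarrow> y \<in> spine E \<and> x \<in> tail E"
    using *[of _ y x] E by (auto simp: tailed_def)
  moreover have "\<not> (x \<in> spine E \<and> y \<in> spine E)"
    using assms E spine_tail(1)[OF E(1)] nbrs_iff[of x y] by (auto simp: card_2_iff)
  ultimately show ?thesis using edge_iff[OF E(1) assms(3)] E spine_tail(3)[OF E(1)] by auto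
qed

text \<open>The way back from \<open>tailed\<close> to the blocks; it works because distinct blocks
  have distinct spines.\<close>

lemma tail_eq: "E \<in> B \<Longrightarrow> tail E = {y \<in> X. spine E \<in> tailed y}"
  using spine_tail(5)[of E] inj_spine by (auto simp: tailed_def dest: inj_onD)

end

section \<open>The cycles of spines\<close>

text \<open>\<open>nb\<close> is the neighbourhood in the graph of spines, and \<open>T y\<close> consists of the spines of the
  two blocks in which \<open>y\<close> is a tail; \<open>\<Union>(T y)\<close> is the out-neighbourhood of \<open>y\<close>.\<close>
locale spine_tournament =
  fixes X :: "'a set" and nb :: "'a \<Rightarrow> 'a set" and T :: "'a \<Rightarrow> 'a set set"
  assumes fin: "finite X" and card_X: "card X = 11"
    and nb_sub: "nb x \<subseteq> X" and nb_irrefl: "x \<notin> nb x" and nb_sym: "y \<in> nb x \<Longrightarrow> x \<in> nb y"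
    and card_nb: "x \<in> X \<Longrightarrow> card (nb x) = 2"
    and T_shape: "y \<in> X \<Longrightarrow> \<exists>a b c d. distinct [a,b,c,d] \<and> {a,b,c,d} \<subseteq> X - insert y (nb y)
       \<and> b \<in> nb a \<and> d \<in> nb c \<and> T y = {{a,b},{c,d}}"
    and tour: "x \<in> X \<Longrightarrow> y \<in> X \<Longrightarrow> x \<noteq> y \<Longrightarrow> y \<notin> nb x \<Longrightarrow> (x \<in> \<Union>(T y)) \<noteq> (y \<in> \<Union>(T x))"
begin

text \<open>As the graph of spines is 2-regular, these are the vertex sets of unions of spine
  cycles.\<close>

definition closed :: "'a set \<Rightarrow> bool" where
  "closed S \<longleftrightarrow> S \<subseteq> X \<and> (\<forall>x\<in>S. nb x \<subseteq> S)"

lemma closed_finite: "closed S \<Longrightarrow> finite S"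
  using fin finite_subset unfolding closed_def by blast

lemma closed_Diff: "closed S \<Longrightarrow> closed R \<Longrightarrow> closed (S - R)"
  using nb_sym unfolding closed_def by blast

text \<open>A closed set contains both ends of a spine or neither.\<close>

lemma even_outdegree:
  assumes "closed S" "y \<in> S" shows "even (card (S \<inter> \<Union>(T y)))"
proof -
  have "y \<in> X" using assms by (auto simp: closed_def)
  from T_shape[OF this] obtain a b c d where *: "distinct [a,b,c,d]" "b \<in> nb a" "d \<in> nb c" "T y = {{a,b},{c,d}}"
    by (elim exE conjE) (rule that; assumption)
  have "a \<in> S \<longleftrightarrow> b \<in> S" "c \<in> S \<longleftrightarrow> d \<in> S"
    using *(2,3)[THEN nb_sym] *(2,3) assms(1) unfolding closed_def by blast+
  then have "S \<inter> \<Union>(T y) = (if a \<in> S then {a,b} else {}) \<union> (if c \<in> S then {c,d} else {})"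
    using *(4) by auto
  then show ?thesis using *(1) by auto
qed

text \<open>Inside a union of spine cycles of size n there are n(n-3)/2 pairs to be oriented, and every
  out-degree is even because each tail is joined to both ends of a spine.\<close>
lemma closed_card:
  assumes "closed S" shows "4 dvd card S * (card S - 3)"
proof -
  \<comment> \<open>\<open>?A\<close> holds each pair to be oriented in both orders,
    \<open>?D\<close> only in its chosen direction.\<close>
  let ?A = "SIGMA y:S. S - insert y (nb y)" and ?D = "SIGMA y:S. S \<inter> \<Union>(T y)"
  note f = closed_finite[OF assms]
  have SX: "S \<subseteq> X" using assms by (simp add: closed_def)
  have "card (S - insert y (nb y)) = card S - 3" if "y \<in> S" for y
  proof -
    have "insert y (nb y) \<subseteq> S" "finite (nb y)" "card (insert y (nb y)) = 3"
      using that assms card_nb[of y] nb_irrefl[of y] finite_subset[OF nb_sub fin] by (auto simp: closed_def)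
    then show ?thesis by (simp only: card_Diff_subset[OF finite_subset[OF _ f]])
  qed
  then have "card ?A = card S * (card S - 3)" using f by (simp add: card_SigmaI)
  moreover have "?A = ?D \<union> ?D\<inverse>" "?D \<inter> ?D\<inverse> = {}"
  proof -
    have D: "x \<noteq> y \<and> x \<notin> nb y" if "y \<in> S" "x \<in> \<Union>(T y)" for x y
      using T_shape[of y] that SX by blast
    have t: "(x \<in> \<Union>(T y)) \<noteq> (y \<in> \<Union>(T x))" if "x \<in> S" "y \<in> S" "x \<noteq> y" "x \<notin> nb y" for x y
      using tour[of y x] that SX by blast
    show "?A = ?D \<union> ?D\<inverse>"
    proof (intro set_eqI)
      fix p :: "'a \<times> 'a"
      obtain y x where p: "p = (y, x)" by (cases p)
      show "p \<in> ?A \<longleftrightarrow> p \<in> ?D \<union> ?D\<inverse>"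
        unfolding p using D[of x y] D[of y x] t[of x y] nb_sym[of x y] nb_sym[of y x] by auto
    qed
    show "?D \<inter> ?D\<inverse> = {}"
    proof (rule equals0I)
      fix p assume p: "p \<in> ?D \<inter> ?D\<inverse>"
      obtain y x where "p = (y, x)" by (cases p)
      then show False using p D[of y x] t[of x y] by auto
    qed
  qed
  moreover have "card (?D\<inverse>) = card ?D" by (simp add: card_inverse)
  moreover have "finite ?D" using f by auto
  ultimately have "card S * (card S - 3) = 2 * card ?D" by (simp add: card_Un_disjoint)
  moreover have "even (card ?D)" using f even_outdegree[OF assms] by (simp add: card_SigmaI dvd_sum)
  ultimately show ?thesis by auto
qed

text \<open>Sizes 1 and 2 are too small for a vertex with its two neighbours; 5, 6, 9 and 10 violate
  the divisibility.\<close>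

lemma closed_card_cases:
  assumes "closed S" shows "card S \<in> {0,3,4,7,8,11}"
proof -
  have "card S \<le> 11" using assms card_mono[OF fin, of S] card_X by (simp add: closed_def)
  moreover have "3 \<le> card S" if x: "x \<in> S" for x
  proof -
    have "insert x (nb x) \<subseteq> S" "x \<in> X" using assms x by (auto simp: closed_def)
    moreover have "card (insert x (nb x)) = 3"
      using card_nb[OF \<open>x \<in> X\<close>] nb_irrefl[of x] finite_subset[OF nb_sub fin] by simp
    ultimately show ?thesis using card_mono[OF closed_finite[OF assms]] by metis
  qed
  then have "card S = 0 \<or> 3 \<le> card S" by (cases "S = {}") auto
  ultimately have "card S \<in> {0,3,4,5,6,7,8,9,10,11}"
    by (auto simp: le_Suc_eq numeral_eq_Suc)
  then show ?thesis using closed_card[OF assms] by auto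
qed

section \<open>Decomposition into cycles\<close>

definition spine_cycle :: "'a list \<Rightarrow> bool" where
  "spine_cycle xs \<longleftrightarrow> distinct xs \<and> set xs \<subseteq> X \<and> length xs \<ge> 3 \<and>
    (\<forall>i. Suc i < length xs \<longrightarrow> xs ! Suc i \<in> nb (xs ! i)) \<and> xs ! 0 \<in> nb (last xs)"

text \<open>Both neighbours of the last vertex of a longest path lie on the path, and one of them must be its
  first vertex, since inner vertices have used up their degree.\<close>
lemma closed_cycle:
  assumes "closed S" "S \<noteq> {}"
  obtains xs where "spine_cycle xs" "set xs \<subseteq> S"
proof -
  define path where "path xs \<longleftrightarrow> distinct xs \<and> set xs \<subseteq> S \<and> (\<forall>i. Suc i < length xs \<longrightarrow> xs ! Suc i \<in> nb (xs ! i))" for xs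
  have bound: "length xs \<le> card S" if "path xs" for xs
    using that card_mono[OF closed_finite[OF assms(1)], of "set xs"] by (auto simp: path_def distinct_card)
  obtain x where x: "x \<in> S" using assms(2) by blast
  then obtain u w where uw: "nb x = {u,w}" "u \<noteq> w" using card_nb[of x] assms(1) by (auto simp: closed_def card_2_iff)
  \<comment> \<open>Ensures that a longest path has the three vertices which
    \<open>spine_cycle\<close> demands.\<close>
  then have "path [u,x,w]"
    using x assms(1) nb_irrefl[of x] nb_sym[of u x] by (auto simp: path_def closed_def less_Suc_eq nth_Cons')
  then have "\<exists>xs. path xs \<and> (\<forall>ys. path ys \<longrightarrow> length ys \<le> length xs)"
    by (rule ex_has_greatest_nat[where b = "Suc (card S)"]) (simp add: bound le_imp_less_Suc)
  then obtain xs where xs: "path xs" "\<And>ys. path ys \<Longrightarrow> length ys \<le> length xs" by auto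
  have len: "length xs \<ge> 3" using xs(2)[OF \<open>path [u,x,w]\<close>] by simp
  define n where "n = length xs"
  have n: "n \<ge> 3" "xs \<noteq> []" using len by (auto simp: n_def)
  define v where "v = last xs"
  have v: "v = xs ! (n - 1)" using n by (simp add: v_def n_def last_conv_nth)
  have dist: "distinct xs" and sub: "set xs \<subseteq> S" and step: "\<And>i. Suc i < n \<Longrightarrow> xs ! Suc i \<in> nb (xs ! i)"
    using xs(1) by (auto simp: path_def n_def)
  have inj: "xs ! i = xs ! j \<longleftrightarrow> i = j" if "i < n" "j < n" for i j
    using that dist by (simp add: n_def nth_eq_iff_index_eq)
  have vS: "v \<in> S" using v n sub by (auto simp: n_def)
  have in_xs: "y \<in> set xs" if "y \<in> nb v" for y
  proof (rule ccontr)
    assume "y \<notin> set xs"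
    moreover have "y \<in> S" using that vS assms(1) by (auto simp: closed_def)
    moreover have "(xs @ [y]) ! Suc i \<in> nb ((xs @ [y]) ! i)" if "Suc i < length (xs @ [y])" for i
    proof (cases "Suc i < n")
      case True then show ?thesis using step[of i] by (simp add: nth_append n_def)
    next
      case False
      then have "i = n - 1" using that by (simp add: n_def)
      then show ?thesis using \<open>y \<in> nb v\<close> v n by (simp add: nth_append n_def)
    qed
    ultimately have "path (xs @ [y])" using dist sub by (simp add: path_def)
    from xs(2)[OF this] show False by simp
  qed
  have "xs ! (n - 2) \<in> nb v" using nb_sym[OF step[of "n - 2"]] n v by (simp add: numeral_2_eq_2 Suc_diff_Suc)
  moreover have "nb v \<noteq> {xs ! (n - 2)}" using card_nb[of v] vS assms(1) by (auto simp: closed_def)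
  ultimately obtain y where y: "y \<in> nb v" "y \<noteq> xs ! (n - 2)" by blast
  obtain i where i: "i < n" "y = xs ! i" using in_xs[OF y(1)] by (auto simp: in_set_conv_nth n_def)
  have "i \<noteq> n - 1" using y(1) nb_irrefl[of v] v i by auto
  moreover have "i \<noteq> n - 2" using y(2) i by auto
  \<comment> \<open>So the successor of \<open>y\<close> on the path is not \<open>v\<close>, and
    for positive \<open>i\<close> the vertex \<open>y\<close> would have three neighbours.\<close>
  ultimately have i': "Suc (Suc i) < n" using i n by auto
  have "i = 0"
  proof (rule ccontr)
    assume "i \<noteq> 0"
    have "{xs ! (i - 1), xs ! Suc i, v} \<subseteq> nb y"
      using nb_sym[OF step[of "i - 1"]] step[of i] nb_sym[OF y(1)] i i' \<open>i \<noteq> 0\<close> by simp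
    moreover have "card {xs ! (i - 1), xs ! Suc i, v} = 3"
    proof -
      have "i - 1 < n" "Suc i < n" "n - 1 < n" "i - 1 \<noteq> Suc i" "i - 1 \<noteq> n - 1" "Suc i \<noteq> n - 1"
        using i' \<open>i \<noteq> 0\<close> by auto
      then have "xs ! (i - 1) \<noteq> xs ! Suc i" "xs ! (i - 1) \<noteq> v" "xs ! Suc i \<noteq> v" unfolding v using inj by blast+
      then show ?thesis by simp
    qed
    moreover have "card (nb y) = 2" using card_nb[of y] y(1) nb_sub by blast
    ultimately show False using card_mono[OF finite_subset[OF nb_sub fin], of "{xs ! (i - 1), xs ! Suc i, v}" y] by simp
  qed
  then have "spine_cycle xs"
    using dist sub len step y i v_def assms(1) by (auto simp: spine_cycle_def closed_def n_def)
  then show ?thesis using that sub by blast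
qed

lemma nb_eq:
  assumes "x \<in> X" "u \<in> nb x" "w \<in> nb x" "u \<noteq> w" shows "nb x = {u,w}"
  using card_nb[OF assms(1)] assms by (auto simp: card_2_iff)

lemma cycle_nb:
  assumes "spine_cycle xs" "i < length xs"
  shows "nb (xs ! i) = {xs ! (if Suc i = length xs then 0 else Suc i), xs ! (if i = 0 then length xs - 1 else i - 1)}"
proof (rule nb_eq)
  have c: "distinct xs" "set xs \<subseteq> X" "length xs \<ge> 3"
    "\<And>i. Suc i < length xs \<Longrightarrow> xs ! Suc i \<in> nb (xs ! i)" "xs ! 0 \<in> nb (last xs)"
    using assms(1) by (auto simp: spine_cycle_def)
  have l: "last xs = xs ! (length xs - 1)" using c(3) by (intro last_conv_nth) auto
  show "xs ! i \<in> X" using c(2) assms(2) by auto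
  show "xs ! (if Suc i = length xs then 0 else Suc i) \<in> nb (xs ! i)"
    using c(4)[of i] c(5) assms(2) l by (auto simp flip: l) (metis l diff_Suc_1)
  show "xs ! (if i = 0 then length xs - 1 else i - 1) \<in> nb (xs ! i)"
    using nb_sym[OF c(5)] nb_sym[OF c(4)[of "i - 1"]] assms(2) l by auto
  show "xs ! (if Suc i = length xs then 0 else Suc i) \<noteq> xs ! (if i = 0 then length xs - 1 else i - 1)"
    using c(3) assms(2) by (subst nth_eq_iff_index_eq[OF c(1)]) (auto split: if_splits)
qed

lemma cycle_adjacent_iff:
  assumes "spine_cycle xs" "i < length xs" "j < length xs"
  shows "xs ! j \<in> nb (xs ! i) \<longleftrightarrow>
    j = (if Suc i = length xs then 0 else Suc i) \<or> i = (if Suc j = length xs then 0 else Suc j)"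
proof -
  have d: "distinct xs" using assms(1) by (simp add: spine_cycle_def)
  have "(if Suc i = length xs then 0 else Suc i) < length xs" "(if i = 0 then length xs - 1 else i - 1) < length xs"
    using assms(2) by auto
  then have "xs ! j \<in> nb (xs ! i) \<longleftrightarrow> j = (if Suc i = length xs then 0 else Suc i) \<or> j = (if i = 0 then length xs - 1 else i - 1)"
    unfolding cycle_nb[OF assms(1,2)] using nth_eq_iff_index_eq[OF d assms(3)] by simp
  then show ?thesis using assms by (auto split: if_splits)
qed

lemma cycle_closed:
  assumes "spine_cycle xs" shows "closed (set xs)"
  unfolding closed_def
proof (intro conjI ballI)
  show "set xs \<subseteq> X" using assms by (simp add: spine_cycle_def)
  fix x assume "x \<in> set xs"
  then obtain i where i: "i < length xs" "x = xs ! i" by (auto simp: in_set_conv_nth)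
  show "nb x \<subseteq> set xs" unfolding i(2) by (subst cycle_nb[OF assms i(1)], use i(1) in \<open>auto intro!: nth_mem\<close>)
qed

text \<open>Each of four vertices has a single non-neighbour among them, so its even out-degree
  inside \<open>S\<close> is 0, and the pair it forms with that non-neighbour gets no
  direction.\<close>

lemma closed_not_4:
  assumes "closed S" shows "card S \<noteq> 4"
proof
  assume 4: "card S = 4"
  have SX: "S \<subseteq> X" using assms by (simp add: closed_def)
  have empty: "S \<inter> \<Union>(T y) = {}" "card (S - insert y (nb y)) = 1" if y: "y \<in> S" for y
  proof -
    have "insert y (nb y) \<subseteq> S" "finite (nb y)" "card (insert y (nb y)) = 3"
      using y assms card_nb[of y] nb_irrefl[of y] finite_subset[OF nb_sub fin] by (auto simp: closed_def)
    then show c: "card (S - insert y (nb y)) = 1"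
      using 4 by (simp only: card_Diff_subset[OF finite_subset[OF _ closed_finite[OF assms]]])
    have "y \<in> X" using SX y by blast
    from T_shape[OF this] have "S \<inter> \<Union>(T y) \<subseteq> S - insert y (nb y)" by fastforce
    then have "card (S \<inter> \<Union>(T y)) \<le> 1"
      using card_mono[of "S - insert y (nb y)"] closed_finite[OF assms] c by fastforce
    with even_outdegree[OF assms y] have "card (S \<inter> \<Union>(T y)) = 0" by presburger
    then show "S \<inter> \<Union>(T y) = {}" using closed_finite[OF assms] by simp
  qed
  obtain y where y: "y \<in> S" using 4 by fastforce
  then obtain z where z: "S - insert y (nb y) = {z}" using empty(2)[OF y] by (auto simp: card_1_singleton_iff)
  then show False using tour[of y z] y empty(1)[OF y] empty(1)[of z] SX by blast
qed

text \<open>Size 7 is excluded because the complement is closed too and would have size 4.\<close>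

lemma closed_card_eq: assumes "closed S" shows "card S \<in> {0,3,8,11}"
proof -
  have X: "closed X" using nb_sub by (simp add: closed_def)
  have "S \<subseteq> X" using assms by (simp add: closed_def)
  then have "card (X - S) = 11 - card S" using card_X card_Diff_subset[OF closed_finite[OF assms]] by metis
  then show ?thesis
    using closed_card_cases[OF assms] closed_not_4[OF assms] closed_not_4[OF closed_Diff[OF X assms]] by auto
qed

lemma card_cycle: "spine_cycle xs \<Longrightarrow> card (set xs) = length xs"
  by (simp add: spine_cycle_def distinct_card)

lemma cycle_type:
  obtains (one) xs where "spine_cycle xs" "length xs = 11"
  | (two) xs ys where "spine_cycle xs" "spine_cycle ys" "length xs = 8" "length ys = 3" "set xs \<inter> set ys = {}"
proof -
  have X: "closed X" using nb_sub by (simp add: closed_def)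
  have len: "length xs \<in> {3,8,11}" if "spine_cycle xs" for xs
    using closed_card_eq[OF cycle_closed[OF that]] that card_cycle[OF that] by (auto simp: spine_cycle_def)
  have rest: "\<exists>ys. spine_cycle ys \<and> set xs \<inter> set ys = {} \<and> length xs + length ys = 11"
    if xs: "spine_cycle xs" "length xs \<noteq> 11" for xs
  proof -
    have sub: "set xs \<subseteq> X" using xs by (simp add: spine_cycle_def)
    define R where "R = X - set xs"
    have R: "closed R" unfolding R_def by (rule closed_Diff[OF X cycle_closed[OF xs(1)]])
    have cR: "card R = 11 - length xs"
      unfolding R_def using card_X card_cycle[OF xs(1)] sub by (simp add: card_Diff_subset)
    then have "R \<noteq> {}" using len[OF xs(1)] xs(2) by auto
    then obtain ys where ys: "spine_cycle ys" "set ys \<subseteq> R" using closed_cycle[OF R] by metis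
    have "card (R - set ys) = card R - length ys" using card_cycle[OF ys(1)] ys(2) by (simp add: card_Diff_subset)
    moreover have "length ys \<le> card R" using card_mono[OF closed_finite[OF R] ys(2)] card_cycle[OF ys(1)] by simp
    \<comment> \<open>Two triangles would leave a closed set of 5 vertices.\<close>
    ultimately have "length xs + length ys = 11"
      using closed_card_eq[OF closed_Diff[OF R cycle_closed[OF ys(1)]]] len[OF xs(1)] len[OF ys(1)] xs(2) cR by auto
    then show ?thesis using ys by (auto simp: R_def)
  qed
  obtain xs where xs: "spine_cycle xs" using closed_cycle[OF X] card_X by (metis card.empty zero_neq_numeral)
  show thesis
  proof (cases "length xs = 11")
    case True then show thesis using xs one by blast
  next
    case False
    then obtain ys where ys: "spine_cycle ys" "set xs \<inter> set ys = {}" "length xs + length ys = 11" using rest xs by blast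
    then have "length xs = 8 \<and> length ys = 3 \<or> length xs = 3 \<and> length ys = 8" using len[OF xs] False by auto
    then show thesis using two[of xs ys] two[of ys xs] xs ys by blast
  qed
qed

end

section \<open>Enumeration of the tournaments\<close>

text \<open>Vertices are labelled 0..10 so that \<open>nxt m\<close> is the successor along the spine cycles: one
  11-cycle for \<open>m = 0\<close>, an 8-cycle followed by a triangle for \<open>m = 8\<close>. A spine is named by the
  vertex it starts from.\<close>
definition nxt :: "nat \<Rightarrow> nat \<Rightarrow> nat" where
  "nxt m i = (if i = 10 then m else if Suc i = m then 0 else Suc i)"

definition cover :: "nat \<Rightarrow> nat \<times> nat \<Rightarrow> nat list" where
  "cover m c = [fst c, nxt m (fst c), snd c, nxt m (snd c)]"

definition nonadj :: "nat \<Rightarrow> nat \<Rightarrow> nat \<Rightarrow> bool" where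
  "nonadj m y z \<longleftrightarrow> z \<noteq> nxt m y \<and> y \<noteq> nxt m z"

text \<open>Each unordered pair of spines is listed once, the smaller starting vertex first.\<close>

definition candidates :: "nat \<Rightarrow> nat \<Rightarrow> (nat \<times> nat) list" where
  "candidates m y = filter (\<lambda>c. distinct (cover m c) \<and> list_all (\<lambda>z. z \<noteq> y \<and> nonadj m y z) (cover m c))
     (concat (map (\<lambda>j. map (\<lambda>i. (i, j)) [0..<j]) [0..<11]))"

text \<open>\<open>None\<close> marks the pairs joined by a spine, which carry no direction. Since
  \<open>map_option Not\<close> fixes \<open>None\<close>, compatibility of two rows is the same
  equation for every pair.\<close>

definition row :: "nat \<Rightarrow> nat \<Rightarrow> nat \<times> nat \<Rightarrow> bool option list" where
  "row m y c = map (\<lambda>z. if nonadj m y z then Some (z \<in> set (cover m c)) else None) [0..<11]"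

text \<open>In \<open>search\<close>, the rows of all remaining vertices have lost the entries of the vertices already
  treated, so the head of each of them is its entry at the current vertex.\<close>
fun refine :: "bool option \<Rightarrow> ('l \<times> bool option list) list \<Rightarrow> ('l \<times> bool option list) list" where
  "refine a [] = []"
| "refine a ((l, r) # cs) = (if hd r = map_option Not a then (l, tl r) # refine a cs else refine a cs)"

function search :: "('l \<times> bool option list) list list \<Rightarrow> 'l list list" where
  "search [] = [[]]"
| "search (cs # css) = concat (map (\<lambda>(l, r).
     let dss = map2 refine (tl r) css
     in if [] \<in> set dss then [] else map ((#) l) (search dss)) cs)"
  by pat_completeness auto
text \<open>\<open>map2\<close> cuts to the shorter list, so \<open>dss\<close> is no longer than
  \<open>css\<close>.\<close>

termination by (relation "measure length") auto

definition rows where "rows m = map (\<lambda>y. map (\<lambda>c. (c, row m y c)) (candidates m y)) [0..<11]"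

lemma refine_mem: "(l, r) \<in> set cs \<Longrightarrow> hd r = map_option Not a \<Longrightarrow> (l, tl r) \<in> set (refine a cs)"
  by (induction a cs rule: refine.induct) auto

text \<open>Completeness is what the classification rests on: no admissible choice \<open>ps\<close>
  of rows is lost. That the surviving solutions are designs is established separately in
  \<open>kfe_design_cyclic\<close>.\<close>

lemma search_complete:
  assumes "length ps = length css"
    and "\<And>i. i < length css \<Longrightarrow> ps ! i \<in> set (css ! i) \<and> length (snd (ps ! i)) = length css"
    and "\<And>i j. i < j \<Longrightarrow> j < length css \<Longrightarrow> snd (ps ! j) ! i = map_option Not (snd (ps ! i) ! j)"
  shows "map fst ps \<in> set (search css)"
  using assms
proof (induction css arbitrary: ps rule: search.induct)
  case 1
  then show ?case by simp
next
  case (2 cs css)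
  from 2(2) obtain l r qs where ps: "ps = (l, r) # qs" and len: "length qs = length css"
    by (cases ps) auto
  have lr: "(l, r) \<in> set cs" "length r = Suc (length css)" using 2(3)[of 0] by (auto simp: ps)
  have qs: "qs ! i \<in> set (css ! i)" "length (snd (qs ! i)) = Suc (length css)"
    "hd (snd (qs ! i)) = map_option Not (tl r ! i)" if "i < length css" for i
  proof -
    show "qs ! i \<in> set (css ! i)" and *: "length (snd (qs ! i)) = Suc (length css)"
      using 2(3)[of "Suc i"] that by (auto simp: ps)
    then show "hd (snd (qs ! i)) = map_option Not (tl r ! i)"
      using 2(4)[of 0 "Suc i"] that lr(2) by (cases "snd (qs ! i)") (auto simp: ps nth_tl)
  qed
  define dss where "dss = map2 refine (tl r) css"
  have ldss: "length dss = length css" using lr by (simp add: dss_def)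
  \<comment> \<open>The remaining choices agree with the row \<open>r\<close>, so they survive
    \<open>refine\<close>, shortened by the entry for the vertex just treated.\<close>
  have mem: "map (apsnd tl) qs ! i \<in> set (dss ! i)" if "i < length css" for i
    using refine_mem[of "fst (qs ! i)" "snd (qs ! i)" "css ! i" "tl r ! i"] qs[OF that] that len lr
    by (simp add: dss_def apsnd_def map_prod_def case_prod_beta)
  have "map fst (map (apsnd tl) qs) \<in> set (search dss)"
  proof (rule 2(1)[OF lr(1) refl dss_def])
    show "[] \<notin> set dss" using mem by (force simp: in_set_conv_nth ldss)
  next
    fix i assume "i < length dss"
    then show "map (apsnd tl) qs ! i \<in> set (dss ! i) \<and> length (snd (map (apsnd tl) qs ! i)) = length dss"
      using mem[of i] qs(2)[of i] ldss len by simp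
  next
    fix i j assume "i < j" "j < length dss"
    then show "snd (map (apsnd tl) qs ! j) ! i = map_option Not (snd (map (apsnd tl) qs ! i) ! j)"
      using 2(4)[of "Suc i" "Suc j"] qs(2)[of i] qs(2)[of j] ldss len by (simp add: ps nth_tl)
  qed (simp add: ldss len)
  then have "map fst qs \<in> set (search dss)" by (simp add: comp_def)
  moreover have "[] \<notin> set dss" using mem by (force simp: in_set_conv_nth ldss)
  ultimately have *: "map fst ps \<in> set ((\<lambda>(l, r).
     let dss = map2 refine (tl r) css
     in if [] \<in> set dss then [] else map ((#) l) (search dss)) (l, r))"
    unfolding prod.case Let_def ps dss_def[symmetric] by simp
  show ?case unfolding search.simps set_concat set_map
    by (rule UnionI, (rule imageI)+, rule lr(1), rule *)
qed

text \<open>Counting admits the type 8 + 3, as 4 divides both 8 * 5 and 3 * 0; exhaustive evaluation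
  rules it out.\<close>

lemma search_8: "search (rows 8) = []" by code_simp

text \<open>Both orders are allowed because \<open>candidates\<close> sorts each pair, and reduction
  modulo 11 may put either start first.\<close>

definition rotational :: "nat \<Rightarrow> nat \<Rightarrow> (nat \<times> nat) list \<Rightarrow> bool" where
  "rotational a b cs \<longleftrightarrow> list_all (\<lambda>y. cs ! y = ((y + a) mod 11, (y + b) mod 11) \<or>
     cs ! y = ((y + b) mod 11, (y + a) mod 11)) [0..<11]"

text \<open>The first two offset pairs become the last two, in the same order, when each offset c is
  replaced by 10 - c.\<close>

lemma search_0: "list_all (\<lambda>cs. rotational 2 4 cs \<or> rotational 2 6 cs \<or> rotational 6 8 cs \<or> rotational 4 8 cs)
   (search (rows 0))" by code_simp

section \<open>Numbering the vertices along the spine cycles\<close>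

context spine_tournament
begin

definition labelling :: "nat \<Rightarrow> (nat \<Rightarrow> 'a) \<Rightarrow> bool" where
  "labelling m h \<longleftrightarrow> bij_betw h {..<11} X \<and>
    (\<forall>i<11. \<forall>j<11. h j \<in> nb (h i) \<longleftrightarrow> \<not> nonadj m i j)"

lemma labelling_exists: "(\<exists>h. labelling 0 h) \<or> (\<exists>h. labelling 8 h)"
proof (cases rule: cycle_type)
  case (one xs)
  then have "set xs = X" "distinct xs"
    using card_cycle[OF one(1)] card_subset_eq[OF fin, of "set xs"] card_X by (auto simp: spine_cycle_def)
  then have "bij_betw (\<lambda>i. xs ! i) {..<11} X" using one(2) by (intro bij_betw_nth) auto
  moreover have "xs ! j \<in> nb (xs ! i) \<longleftrightarrow> \<not> nonadj 0 i j" if "i < 11" "j < 11" for i j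
    using cycle_adjacent_iff[OF one(1), of i j] that one(2) by (auto simp: nonadj_def nxt_def)
  ultimately have "labelling 0 (\<lambda>i. xs ! i)" by (simp add: labelling_def)
  then show ?thesis by blast
next
  case (two xs ys)
  \<comment> \<open>The 8-cycle gets the labels 0 to 7 and the triangle 8 to 10, as
    \<open>nxt 8\<close> prescribes.\<close>
  let ?zs = "xs @ ys"
  have sub: "set xs \<subseteq> X" "set ys \<subseteq> X" and d: "distinct xs" "distinct ys"
    using two by (auto simp: spine_cycle_def)
  then have dz: "distinct ?zs" using two(5) by simp
  have "set ?zs = X"
  proof (rule card_subset_eq[OF fin])
    show "card (set ?zs) = card X" using distinct_card[OF dz] two(3,4) card_X by simp
  qed (use sub in auto)
  then have "bij_betw (\<lambda>i. ?zs ! i) {..<11} X" using dz two(3,4) by (intro bij_betw_nth) auto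
  moreover have "?zs ! j \<in> nb (?zs ! i) \<longleftrightarrow> \<not> nonadj 8 i j" if ij: "i < 11" "j < 11" for i j
  proof -
    have cl: "closed (set xs)" "closed (set ys)" using two cycle_closed by auto
    consider "i < 8" "j < 8" | "i < 8" "j \<ge> 8" | "i \<ge> 8" "j < 8" | "i \<ge> 8" "j \<ge> 8" by linarith
    then show ?thesis
    proof cases
      case 1
      then show ?thesis using cycle_adjacent_iff[OF two(1), of i j] two(3)
        by (auto simp: nth_append nonadj_def nxt_def)
    next
      case 2
      then have "?zs ! i \<in> set xs" "?zs ! j \<in> set ys" using two(3,4) ij by (auto simp: nth_append)
      then have "?zs ! j \<notin> nb (?zs ! i)" using cl two(5) unfolding closed_def by blast
      moreover have "nonadj 8 i j" using 2 ij by (auto simp: nonadj_def nxt_def)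
      ultimately show ?thesis by simp
    next
      case 3
      then have "?zs ! i \<in> set ys" "?zs ! j \<in> set xs" using two(3,4) ij by (auto simp: nth_append)
      then have "?zs ! j \<notin> nb (?zs ! i)" using cl two(5) unfolding closed_def by blast
      moreover have "nonadj 8 i j" using 3 ij by (auto simp: nonadj_def nxt_def)
      ultimately show ?thesis by simp
    next
      case 4
      then obtain k l where kl: "i = 8 + k" "j = 8 + l" using le_Suc_ex[of 8 i] le_Suc_ex[of 8 j] by blast
      then have "?zs ! i = ys ! k" "?zs ! j = ys ! l" using two(3) by (simp_all add: nth_append)
      moreover have "k < 3" "l < 3" using kl ij by auto
      moreover have "l = (if Suc k = 3 then 0 else Suc k) \<or> k = (if Suc l = 3 then 0 else Suc l) \<longleftrightarrow> \<not> nonadj 8 i j"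
        using \<open>k < 3\<close> \<open>l < 3\<close> unfolding kl nonadj_def nxt_def by (auto split: if_splits)
      ultimately show ?thesis using cycle_adjacent_iff[OF two(2), of k l] two(4) by simp
    qed
  qed
  ultimately have "labelling 8 (\<lambda>i. ?zs ! i)" by (simp add: labelling_def)
  then show ?thesis by blast
qed

context
  fixes m h
  assumes m: "m \<in> {0, 8}" and lab: "labelling m h"
begin

lemma label_bij: "bij_betw h {..<11} X" using lab by (simp add: labelling_def)

lemma nxt_less: "i < 11 \<Longrightarrow> nxt m i < 11" using m by (auto simp: nxt_def)

lemma label_inj: "i < 11 \<Longrightarrow> j < 11 \<Longrightarrow> h i = h j \<longleftrightarrow> i = j"
  using inj_on_eq_iff[OF bij_betw_imp_inj_on[OF label_bij]] by simp

lemma label_mem: "i < 11 \<Longrightarrow> h i \<in> X"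
  using bij_betwE[OF label_bij] by simp

lemma label_obtain: assumes "x \<in> X" obtains i where "i < 11" "x = h i"
  using assms bij_betw_imp_surj_on[OF label_bij] by blast

lemma label_adj: "i < 11 \<Longrightarrow> j < 11 \<Longrightarrow> h j \<in> nb (h i) \<longleftrightarrow> \<not> nonadj m i j"
  using lab by (simp add: labelling_def)

lemma label_edge: assumes "b \<in> nb a" obtains i where "i < 11" "{a,b} = h ` {i, nxt m i}"
proof -
  have "a \<in> X" "b \<in> X" using assms nb_sub nb_sym by blast+
  then obtain i j where ij: "i < 11" "a = h i" "j < 11" "b = h j" using label_obtain by metis
  then have "j = nxt m i \<or> i = nxt m j" using assms label_adj by (auto simp: nonadj_def)
  then have "{a,b} = h ` {i, nxt m i} \<or> {a,b} = h ` {j, nxt m j}" using ij by auto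
  then show ?thesis using that ij by blast
qed

definition labelled_pair :: "nat \<times> nat \<Rightarrow> 'a set set" where
  "labelled_pair c = {h ` {fst c, nxt m (fst c)}, h ` {snd c, nxt m (snd c)}}"

lemma Union_labelled_pair: "\<Union>(labelled_pair c) = h ` set (cover m c)"
  by (auto simp: labelled_pair_def cover_def)

lemma candidate_exists:
  assumes "y < 11"
  shows "\<exists>c\<in>set (candidates m y). T (h y) = labelled_pair c"
proof -
  from T_shape[OF label_mem[OF assms]] obtain a b c d where T: "distinct [a,b,c,d]"
    "{a,b,c,d} \<subseteq> X - insert (h y) (nb (h y))" "b \<in> nb a" "d \<in> nb c" "T (h y) = {{a,b},{c,d}}"
    by (elim exE conjE) (rule that; assumption)
  obtain i where i: "i < 11" "{a,b} = h ` {i, nxt m i}" using label_edge[OF T(3)] by metis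
  obtain j where j: "j < 11" "{c,d} = h ` {j, nxt m j}" using label_edge[OF T(4)] by metis
  have cand: "p \<in> set (candidates m y)"
    if "p = (min i j, max i j)" "set (cover m p) = {i, nxt m i, j, nxt m j}" for p
  proof -
    \<comment> \<open>Four image points force the four entries of \<open>cover m p\<close> to be
      distinct.\<close>
    have im: "h ` set (cover m p) = {a,b,c,d}" using i(2) j(2) that(2) by auto
    moreover have "card {a,b,c,d} = 4" using T(1) by simp
    ultimately have "4 \<le> card (set (cover m p))" by (metis card_image_le List.finite_set)
    then have "distinct (cover m p)"
      using card_length[of "cover m p"] by (intro card_distinct) (simp add: cover_def)
    moreover have "z \<noteq> y \<and> nonadj m y z" if "z \<in> set (cover m p)" for z
    proof -
      have "h z \<in> {a,b,c,d}" using im that by blast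
      then have "h z \<noteq> h y" "h z \<notin> nb (h y)" using T(2) by auto
      moreover have "z < 11" using that \<open>set (cover m p) = _\<close> i j nxt_less by auto
      ultimately show ?thesis using label_adj[OF assms, of z] by auto
    qed
    moreover have "i \<noteq> j" using \<open>distinct (cover m p)\<close> that(1) by (auto simp: cover_def)
    ultimately show ?thesis using i(1) j(1) that(1)
      by (auto simp: candidates_def list_all_iff min_def max_def image_iff)
  qed
  have "T (h y) = labelled_pair (min i j, max i j)" using T(5) i(2) j(2)
    by (auto simp: labelled_pair_def min_def max_def)
  moreover have "set (cover m (min i j, max i j)) = {i, nxt m i, j, nxt m j}"
    by (auto simp: cover_def min_def max_def)
  ultimately show ?thesis using cand[OF refl] by blast
qed

lemma labelled_solution:
  "\<exists>cs\<in>set (search (rows m)). \<forall>y<11. T (h y) = labelled_pair (cs ! y)"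
proof -
  from candidate_exists obtain f where f: "f y \<in> set (candidates m y)" "T (h y) = labelled_pair (f y)" if "y < 11" for y
    by metis
  define ps where "ps = map (\<lambda>y. (f y, row m y (f y))) [0..<11]"
  have "map fst ps \<in> set (search (rows m))"
  proof (rule search_complete)
    show "length ps = length (rows m)" by (simp add: ps_def rows_def)
  next
    fix i assume "i < length (rows m)"
    then have "i < 11" by (simp add: rows_def)
    have len: "length (rows m) = 11" "length (row m i (f i)) = 11" by (simp_all add: rows_def row_def)
    from \<open>i < 11\<close> have "ps ! i = (f i, row m i (f i))" "rows m ! i = map (\<lambda>c. (c, row m i c)) (candidates m i)"
      by (simp_all add: ps_def rows_def)
    then show "ps ! i \<in> set (rows m ! i) \<and> length (snd (ps ! i)) = length (rows m)"
      using imageI[OF f(1)[OF \<open>i < 11\<close>], of "\<lambda>c. (c, row m i c)"] by (simp add: len)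
  next
    fix i j assume "i < j" "j < length (rows m)"
    then have ij: "i < 11" "j < 11" "i \<noteq> j" by (auto simp: rows_def)
    \<comment> \<open>This is \<open>tour\<close> read through \<open>h\<close>; for adjacent labels
      both row entries are \<open>None\<close>.\<close>
    have "(i \<in> set (cover m (f j))) \<noteq> (j \<in> set (cover m (f i)))" if "nonadj m i j"
    proof -
      have mem: "h a \<in> \<Union>(T (h b)) \<longleftrightarrow> a \<in> set (cover m (f b))" if "a < 11" "b < 11" for a b
      proof -
        have "c < 11" if "c \<in> set (cover m (f b))" for c
          using that f(1)[OF \<open>b < 11\<close>] nxt_less by (auto simp: cover_def candidates_def)
        then show ?thesis unfolding f(2)[OF \<open>b < 11\<close>] Union_labelled_pair using label_inj that by blast
      qed
      show ?thesis
        using tour[of "h i" "h j"] label_mem ij label_inj label_adj that mem[of i j] mem[of j i] by auto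
    qed
    moreover have "nonadj m j i = nonadj m i j" by (auto simp: nonadj_def)
    ultimately show "snd (ps ! j) ! i = map_option Not (snd (ps ! i) ! j)"
      using ij by (auto simp: ps_def row_def)
  qed
  moreover have "map fst ps ! y = f y" if "y < 11" for y using that by (simp add: ps_def)
  ultimately show ?thesis using f(2) by metis
qed

end

lemma rotational_labelling:
  obtains h :: "nat \<Rightarrow> 'a" and a b :: nat where "bij_betw h {..<11} X" "(a, b) \<in> {(2,4),(2,6),(6,8),(4,8)}"
    "\<And>i. i < 11 \<Longrightarrow> h ((i + 1) mod 11) \<in> nb (h i)"
    "\<And>x y. y \<in> nb x \<Longrightarrow> \<exists>i<11. {x,y} = h ` {i, (i + 1) mod 11}"
    "\<And>y. y < 11 \<Longrightarrow> T (h y) =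
      {h ` {(y + a) mod 11, ((y + a) mod 11 + 1) mod 11}, h ` {(y + b) mod 11, ((y + b) mod 11 + 1) mod 11}}"
proof -
  have no8: "\<not> labelling 8 h" for h using labelled_solution[of 8 h] by (auto simp: search_8)
  then obtain h where h: "labelling 0 h" using labelling_exists by blast
  obtain cs where cs: "cs \<in> set (search (rows 0))" "\<forall>y<11. T (h y) = labelled_pair 0 h (cs ! y)"
    using labelled_solution[of 0 h] h by auto
  have "rotational 2 4 cs \<or> rotational 2 6 cs \<or> rotational 6 8 cs \<or> rotational 4 8 cs"
    using search_0[unfolded list_all_iff] cs(1) by (rule bspec)
  then obtain a b where ab: "(a, b) \<in> {(2,4),(2,6),(6,8),(4,8)}" "rotational a b cs"
    by (elim disjE) (erule that[rotated]; simp)+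
  have nxt: "nxt 0 i = (i + 1) mod 11" if "i < 11" for i :: nat using that by (auto simp: nxt_def)
  show thesis
  proof (rule that[OF label_bij[OF _ h] ab(1)])
    show "h ((i + 1) mod 11) \<in> nb (h i)" if "i < 11" for i
      using label_adj[OF _ h that, of "(i + 1) mod 11"] nxt[OF that] by (auto simp: nonadj_def)
    show "\<exists>i<11. {x,y} = h ` {i, (i + 1) mod 11}" if "y \<in> nb x" for x y
      using label_edge[OF _ h that] nxt by (metis insertI1)
    show "T (h y) = {h ` {(y + a) mod 11, ((y + a) mod 11 + 1) mod 11}, h ` {(y + b) mod 11, ((y + b) mod 11 + 1) mod 11}}"
      if "y < 11" for y
    proof -
      have "cs ! y = ((y + a) mod 11, (y + b) mod 11) \<or> cs ! y = ((y + b) mod 11, (y + a) mod 11)"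
        using ab(2) that by (simp add: rotational_def list_all_iff)
      moreover have "nxt 0 ((y + c) mod 11) = ((y + c) mod 11 + 1) mod 11" for c by (rule nxt) simp
      moreover have "T (h y) = labelled_pair 0 h (cs ! y)" using cs(2) that by blast
      ultimately show ?thesis using labelled_pair_def[OF _ h, of "cs ! y"] by (elim disjE) (simp_all add: insert_commute)
    qed
  qed simp
qed

end

section \<open>The two cyclic designs\<close>

text \<open>The action used in \<open>kfe_iso\<close>, but between two vertex types, so that designs
  on \<open>{..<11}\<close> can be carried to \<open>X\<close>.\<close>

definition image_design :: "('a \<Rightarrow> 'b) \<Rightarrow> 'a set set set \<Rightarrow> 'b set set set" where
  "image_design f B = (\<lambda>E. (\<lambda>e. f ` e) ` E) ` B"

lemma image_kfe_edges: "(\<lambda>e. f ` e) ` kfe_edges a b c d = kfe_edges (f a) (f b) (f c) (f d)"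
  by (simp add: kfe_edges_def)

lemma image_design_comp: "image_design g (image_design f B) = image_design (g \<circ> f) B"
  by (simp add: image_design_def image_comp comp_def)

lemma kfe_block_edges: "kfe_block X E \<Longrightarrow> e \<in> E \<Longrightarrow> e \<subseteq> X"
  by (auto simp: kfe_block_def kfe_edges_def)

lemma image_design_cong:
  assumes "kfe_design X B" "\<And>x. x \<in> X \<Longrightarrow> f x = g x"
  shows "image_design f B = image_design g B"
proof -
  have *: "f ` e = g ` e" if "E \<in> B" "e \<in> E" for E e
    using that assms kfe_block_edges[of X E e] by (intro image_cong) (auto simp: kfe_design_def)
  have "(\<lambda>e. f ` e) ` E = (\<lambda>e. g ` e) ` E" if "E \<in> B" for E
    by (rule image_cong[OF refl]) (rule *[OF that])
  then show ?thesis unfolding image_design_def by (rule image_cong[OF refl])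
qed

lemma kfe_design_image:
  assumes f: "bij_betw f Y X" and B: "kfe_design Y B"
  shows "kfe_design X (image_design f B)"
  unfolding kfe_design_def
proof (intro conjI ballI impI)
  have inj: "inj_on f Y" using f by (rule bij_betw_imp_inj_on)
  have Y: "f ` Y = X" using f by (rule bij_betw_imp_surj_on)
  fix E' assume "E' \<in> image_design f B"
  then obtain E where E: "E \<in> B" "E' = (\<lambda>e. f ` e) ` E" by (auto simp: image_design_def)
  then obtain a b c d where "distinct [a,b,c,d]" "{a,b,c,d} \<subseteq> Y" "E = kfe_edges a b c d"
    using B by (auto simp: kfe_design_def kfe_block_def)
  then have "distinct [f a, f b, f c, f d]" "{f a, f b, f c, f d} \<subseteq> X" "E' = kfe_edges (f a) (f b) (f c) (f d)"
    using inj Y E(2) image_kfe_edges[of f] by (auto dest: inj_onD)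
  then show "kfe_block X E'" unfolding kfe_block_def by blast
next
  have inj: "inj_on f Y" using f by (rule bij_betw_imp_inj_on)
  have Y: "f ` Y = X" using f by (rule bij_betw_imp_surj_on)
  fix x y assume xy: "x \<in> X" "y \<in> X" "x \<noteq> y"
  then obtain s t where st: "s \<in> Y" "t \<in> Y" "x = f s" "y = f t" "s \<noteq> t" using Y by blast
  have mem: "{x,y} \<in> (\<lambda>e. f ` e) ` E \<longleftrightarrow> {s,t} \<in> E" if "E \<in> B" for E
  proof -
    have "e = {s,t}" if "e \<in> E" "f ` e = {x,y}" for e
      using kfe_block_edges[of Y E e] B \<open>E \<in> B\<close> that st inj_on_image_eq_iff[OF inj, of e "{s,t}"]
      by (auto simp: kfe_design_def)
    moreover have "{x,y} \<in> (\<lambda>e. f ` e) ` E" if "{s,t} \<in> E"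
      using imageI[OF that, of "\<lambda>e. f ` e"] st by simp
    ultimately show ?thesis by auto
  qed
  have "\<exists>!E. E \<in> B \<and> {s,t} \<in> E" using B st by (simp add: kfe_design_def)
  then obtain E where E: "E \<in> B" "{s,t} \<in> E" "\<And>F. F \<in> B \<Longrightarrow> {s,t} \<in> F \<Longrightarrow> F = E" by auto
  show "\<exists>!E. E \<in> image_design f B \<and> {x,y} \<in> E"
  proof (rule ex1I)
    show "(\<lambda>e. f ` e) ` E \<in> image_design f B \<and> {x,y} \<in> (\<lambda>e. f ` e) ` E"
      using mem[OF E(1)] E(1,2) unfolding image_design_def by blast
    fix F' assume "F' \<in> image_design f B \<and> {x,y} \<in> F'"
    then obtain F where "F \<in> B" "F' = (\<lambda>e. f ` e) ` F" "{x,y} \<in> F'" by (auto simp: image_design_def)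
    then have "F = E" using mem[of F] E(3) by simp
    then show "F' = (\<lambda>e. f ` e) ` E" using \<open>F' = _\<close> by simp
  qed
qed

text \<open>The isomorphism goes back to \<open>Y\<close> along \<open>h\<close> and out again along
  \<open>g\<close>.\<close>

lemma kfe_iso_images:
  assumes h: "bij_betw h Y X" and g: "bij_betw g Y X" and B: "kfe_design Y B"
  shows "kfe_iso X (image_design h B) (image_design g B)"
proof -
  let ?\<pi> = "g \<circ> inv_into Y h"
  have "bij_betw ?\<pi> X X" using bij_betw_trans[OF bij_betw_inv_into[OF h] g] .
  moreover have "image_design ?\<pi> (image_design h B) = image_design g B"
    unfolding image_design_comp using bij_betw_imp_inj_on[OF h] by (intro image_design_cong[OF B]) simp
  ultimately show ?thesis unfolding kfe_iso_def image_design_def by blast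
qed

text \<open>The invariant separating the two designs: in the Hamiltonian cycle of spines, the tails of a
  block are at distance at most 2.\<close>
definition close_tails :: "'a set set set \<Rightarrow> bool" where
  "close_tails B \<longleftrightarrow> (\<exists>E\<in>B. \<exists>F\<in>B. \<exists>G\<in>B. tail E \<subseteq> spine F \<union> spine G \<and> spine F \<inter> spine G \<noteq> {})"

text \<open>On blocks, \<open>spine\<close> and \<open>tail\<close> commute with maps that are
  injective on \<open>X\<close>.\<close>

lemma close_tails_image:
  assumes "kfe_design X B" "inj_on f X" "close_tails B"
  shows "close_tails (image_design f B)"
proof -
  have im: "spine ((\<lambda>e. f ` e) ` E) = f ` spine E" "tail ((\<lambda>e. f ` e) ` E) = f ` tail E" if E: "E \<in> B" for E
  proof -
    from E obtain a b c d where *: "distinct [a,b,c,d]" "{a,b,c,d} \<subseteq> X" "E = kfe_edges a b c d"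
      using assms(1) by (auto simp: kfe_design_def kfe_block_def)
    then have "distinct [f a, f b, f c, f d]" using assms(2) by (auto dest: inj_onD)
    then show "spine ((\<lambda>e. f ` e) ` E) = f ` spine E" "tail ((\<lambda>e. f ` e) ` E) = f ` tail E"
      using *(1) by (simp_all only: *(3) image_kfe_edges spine_kfe_edges tail_kfe_edges image_insert image_empty)
  qed
  from assms(3) obtain E F G where EFG: "E \<in> B" "F \<in> B" "G \<in> B" "tail E \<subseteq> spine F \<union> spine G"
    "spine F \<inter> spine G \<noteq> {}" by (auto simp: close_tails_def)
  then have "f ` tail E \<subseteq> f ` spine F \<union> f ` spine G" "f ` spine F \<inter> f ` spine G \<noteq> {}" by auto
  then show ?thesis unfolding close_tails_def image_design_def using EFG(1-3) im by (metis imageI)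
qed

text \<open>The summand 11 keeps the subtraction from being truncated.\<close>
definition base_block :: "nat \<Rightarrow> nat \<Rightarrow> nat \<Rightarrow> nat set set" where
  "base_block a b j = kfe_edges j ((j + 1) mod 11) ((j + 11 - a) mod 11) ((j + 11 - b) mod 11)"

text \<open>The offsets are those of \<open>rotational\<close>: y is a tail of the spines starting
  at y + a and y + b, so the spine starting at j has the tails j - a and j - b modulo 11.\<close>

definition cyclic_design :: "nat \<Rightarrow> nat \<Rightarrow> nat set set set" where
  "cyclic_design a b = base_block a b ` {..<11}"

lemma image_cyclic_design:
  "image_design h (cyclic_design a b) =
    (\<lambda>j. kfe_edges (h j) (h ((j + 1) mod 11)) (h ((j + 11 - a) mod 11)) (h ((j + 11 - b) mod 11))) ` {..<11}"
  by (simp add: image_design_def cyclic_design_def base_block_def image_image image_kfe_edges)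

text \<open>Membership of the pair in \<open>base_block a b j\<close>, as in
  \<open>mem_kfe_edges_iff\<close>, but with lists in place of sets of edges so that it can be
  evaluated.\<close>

definition covers :: "nat \<Rightarrow> nat \<Rightarrow> nat \<Rightarrow> nat \<Rightarrow> nat \<Rightarrow> bool" where
  "covers a b j x y \<longleftrightarrow> (let s = [j, (j + 1) mod 11]; t = [(j + 11 - a) mod 11, (j + 11 - b) mod 11] in
    x \<in> set s \<and> y \<in> set s \<or> x \<in> set s \<and> y \<in> set t \<or> x \<in> set t \<and> y \<in> set s)"

lemma base_block_distinct:
  fixes a b j :: nat
  assumes "(a, b) \<in> {(2, 4), (2, 6)}" "j < 11"
  shows "distinct [j, (j + 1) mod 11, (j + 11 - a) mod 11, (j + 11 - b) mod 11]"
proof -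
  have "\<forall>j\<in>set [0..<11]. distinct [j, (j + 1) mod 11, (j + 11 - 2) mod 11, (j + 11 - 4) mod 11]"
    "\<forall>j\<in>set [0..<11]. distinct [j, (j + 1) mod 11, (j + 11 - 2) mod 11, (j + 11 - 6) mod 11]"
    by code_simp+
  note chk = this[THEN bspec]
  have "j \<in> set [0..<11]" using assms(2) by (simp only: set_upt atLeastLessThan_iff le0 simp_thms)
  note chk = chk[OF this]
  from assms(1) consider "a = 2" "b = 4" | "a = 2" "b = 6" by auto
  then show ?thesis by cases (use chk in \<open>simp_all only:\<close>)
qed

text \<open>The edges of a base block have the cyclic distances 1, 2, 4, 3, 5 for the offsets 2, 4
  and 1, 2, 5, 3, 4 for the offsets 2, 6. Each distance occurs once, so the rotations cover each
  pair once. Length 1 of the filtered list is unique existence in executable form.\<close>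

lemma covers_unique:
  fixes a b x y :: nat
  assumes "(a, b) \<in> {(2, 4), (2, 6)}" "x < 11" "y < 11" "x \<noteq> y"
  shows "length (filter (\<lambda>j. covers a b j x y) [0..<11]) = 1"
proof -
  have "\<forall>x\<in>set [0..<11]. \<forall>y\<in>set [0..<11]. x = y \<or> length (filter (\<lambda>j. covers 2 4 j x y) [0..<11]) = 1"
    "\<forall>x\<in>set [0..<11]. \<forall>y\<in>set [0..<11]. x = y \<or> length (filter (\<lambda>j. covers 2 6 j x y) [0..<11]) = 1"
    by code_simp+
  note chk = this[THEN bspec, THEN bspec]
  have "x \<in> set [0..<11]" "y \<in> set [0..<11]"
    using assms(2,3) by (simp_all only: set_upt atLeastLessThan_iff le0 simp_thms)
  note chk = chk[OF this]
  from assms(1) consider "a = 2" "b = 4" | "a = 2" "b = 6" by auto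
  then show ?thesis by cases (use chk assms(4) in \<open>simp_all only: simp_thms\<close>)
qed

lemma kfe_design_cyclic:
  assumes ab: "(a, b) \<in> {(2, 4), (2, 6)}"
  shows "kfe_design {..<11} (cyclic_design a b)"
  unfolding kfe_design_def
proof (intro conjI ballI impI)
  fix E assume "E \<in> cyclic_design a b"
  then obtain j where "j < 11" "E = base_block a b j" by (auto simp: cyclic_design_def)
  then show "kfe_block {..<11} E" using base_block_distinct[OF ab, of j]
    unfolding kfe_block_def base_block_def by (intro exI conjI) auto
next
  fix x y :: nat assume xy: "x \<in> {..<11}" "y \<in> {..<11}" "x \<noteq> y"
  then have "length (filter (\<lambda>j. covers a b j x y) [0..<11]) = 1" by (intro covers_unique[OF ab]) auto
  then have "Suc 0 = length (filter (\<lambda>j. covers a b j x y) [0..<11])" by (rule trans[OF One_nat_def[symmetric] sym])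
  then obtain j where "filter (\<lambda>j. covers a b j x y) [0..<11] = [j]"
    unfolding Suc_length_conv length_0_conv by blast
  then have "set (filter (\<lambda>j. covers a b j x y) [0..<11]) = set [j]" by (rule arg_cong)
  then have *: "i < 11 \<and> covers a b i x y \<longleftrightarrow> i = j" for i
    unfolding set_filter set_upt set_eq_iff by simp
  have mem: "{x,y} \<in> base_block a b i \<longleftrightarrow> covers a b i x y" if "i < 11" for i
    unfolding base_block_def covers_def Let_def mem_kfe_edges_iff[OF base_block_distinct[OF ab that] xy(3)] by simp
  show "\<exists>!E. E \<in> cyclic_design a b \<and> {x,y} \<in> E"
  proof (rule ex1I)
    show "base_block a b j \<in> cyclic_design a b \<and> {x,y} \<in> base_block a b j"
      using *[of j] mem[of j] by (auto simp: cyclic_design_def)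
    show "E = base_block a b j" if E: "E \<in> cyclic_design a b \<and> {x,y} \<in> E" for E
    proof -
      obtain i where i: "i < 11" "E = base_block a b i" "{x,y} \<in> E" using E by (auto simp: cyclic_design_def)
      then show ?thesis using *[of i] mem[of i] by simp
    qed
  qed
qed

lemma spine_tail_base_block:
  assumes "(a, b) \<in> {(2, 4), (2, 6)}" "j < 11"
  shows "spine (base_block a b j) = {j, (j + 1) mod 11}"
    "tail (base_block a b j) = {(j + 11 - a) mod 11, (j + 11 - b) mod 11}"
  unfolding base_block_def
  by (rule spine_kfe_edges[OF base_block_distinct[OF assms]], rule tail_kfe_edges[OF base_block_distinct[OF assms]])

section \<open>The two designs are not isomorphic\<close>

lemma close_tails_2_4: "close_tails (cyclic_design 2 4)"
proof -
  \<comment> \<open>Block 4 has the tails 2 and 0, which the spines {0,1} and {1,2} cover.\<close>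
  have *: "tail (base_block 2 4 4) \<subseteq> spine (base_block 2 4 0) \<union> spine (base_block 2 4 1)"
    "spine (base_block 2 4 0) \<inter> spine (base_block 2 4 1) \<noteq> {}"
    by (simp_all add: spine_tail_base_block)
  have "base_block 2 4 4 \<in> cyclic_design 2 4" "base_block 2 4 0 \<in> cyclic_design 2 4" "base_block 2 4 1 \<in> cyclic_design 2 4"
    unfolding cyclic_design_def by (rule imageI, simp)+
  note mem = this[THEN bexI[rotated]]
  show ?thesis unfolding close_tails_def by (rule mem(1), rule mem(2), rule mem(3), rule conjI) (rule *)+
qed

text \<open>The tails j - 2 and j - 6 are at distance 4 on the cycle, while two spines that meet
  span at most three consecutive vertices.\<close>

lemma not_close_tails_2_6: "\<not> close_tails (cyclic_design 2 6)"
proof -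
  have chk: "\<forall>j\<in>set [0..<11]. \<forall>k\<in>set [0..<11]. \<forall>l\<in>set [0..<11].
      \<not> ({(j + 11 - 2) mod 11, (j + 11 - 6) mod 11} \<subseteq> {k, (k + 1) mod 11} \<union> {l, (l + 1) mod 11} \<and>
      {k, (k + 1) mod 11} \<inter> {l, (l + 1) mod 11} \<noteq> {})"
    by code_simp
  have *: "\<not> ({(j + 11 - 2) mod 11, (j + 11 - 6) mod 11} \<subseteq> {k, (k + 1) mod 11} \<union> {l, (l + 1) mod 11} \<and>
      {k, (k + 1) mod 11} \<inter> {l, (l + 1) mod 11} \<noteq> {})" if "j < 11" "k < 11" "l < 11" for j k l :: nat
    by (rule chk[THEN bspec, THEN bspec, THEN bspec]) (use that in \<open>simp_all only: set_upt atLeastLessThan_iff le0 simp_thms\<close>)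
  show ?thesis
  proof
    assume "close_tails (cyclic_design 2 6)"
    then obtain j k l where jkl: "j < 11" "k < 11" "l < 11"
      "tail (base_block 2 6 j) \<subseteq> spine (base_block 2 6 k) \<union> spine (base_block 2 6 l)"
      "spine (base_block 2 6 k) \<inter> spine (base_block 2 6 l) \<noteq> {}"
      by (auto simp: close_tails_def cyclic_design_def)
    have "(2, 6) \<in> {(2, 4), (2, 6 :: nat)}" by simp
    note st = spine_tail_base_block[OF this]
    show False using *[OF jkl(1-3)] jkl(4,5)
      unfolding st(2)[OF jkl(1)] st(1)[OF jkl(2)] st(1)[OF jkl(3)] by blast
  qed
qed

lemma not_iso_cyclic:
  assumes g: "bij_betw g {..<11} X"
  shows "\<not> kfe_iso X (image_design g (cyclic_design 2 4)) (image_design g (cyclic_design 2 6))"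
proof
  let ?B1 = "image_design g (cyclic_design 2 4)" and ?B2 = "image_design g (cyclic_design 2 6)"
  have des: "kfe_design {..<11} (cyclic_design 2 4)" "kfe_design {..<11} (cyclic_design 2 6)"
    by (simp_all add: kfe_design_cyclic)
  have B: "kfe_design X ?B1" "kfe_design X ?B2" using kfe_design_image[OF g] des by auto
  have inj: "inj_on g {..<11}" using g by (rule bij_betw_imp_inj_on)
  assume "kfe_iso X ?B1 ?B2"
  then obtain \<pi> where \<pi>: "bij_betw \<pi> X X" "image_design \<pi> ?B1 = ?B2"
    unfolding kfe_iso_def image_design_def by blast
  have "close_tails ?B1" by (rule close_tails_image[OF des(1) inj close_tails_2_4])
  then have "close_tails ?B2"
    using close_tails_image[OF B(1) bij_betw_imp_inj_on[OF \<pi>(1)]] \<pi>(2) by simp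
  \<comment> \<open>Pulls the property back to the labels, where it has been refuted by
    evaluation.\<close>
  then have "close_tails (image_design (inv_into {..<11} g) ?B2)"
    using close_tails_image[OF B(2) bij_betw_imp_inj_on[OF bij_betw_inv_into[OF g]]] by simp
  moreover have "image_design (inv_into {..<11} g) ?B2 = image_design id (cyclic_design 2 6)"
    unfolding image_design_comp using inj by (intro image_design_cong[OF des(2)]) simp
  ultimately show False using not_close_tails_2_6 by (simp add: image_design_def)
qed

text \<open>Modulo 11, negation sends the spine {j, j+1} to the one starting at 10 - j, with its
  ends exchanged, and the tail j - c to (10 - j) - (10 - c). So an offset c becomes 10 - c, and the
  two tails change places.\<close>

lemma reflect_cyclic:
  fixes h :: "nat \<Rightarrow> 'a"
  assumes "(a, b, c, d) \<in> {(6, 8, 2, 4), (4, 8, 2, 6)}"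
  shows "image_design h (cyclic_design a b) = image_design (\<lambda>i. h ((11 - i) mod 11)) (cyclic_design c d)"
proof -
  let ?K = "\<lambda>j. kfe_edges (h j) (h ((j + 1) mod 11)) (h ((j + 11 - a) mod 11)) (h ((j + 11 - b) mod 11))"
  let ?r = "\<lambda>i. h ((11 - i) mod 11)"
  have "kfe_edges (?r j) (?r ((j + 1) mod 11)) (?r ((j + 11 - c) mod 11)) (?r ((j + 11 - d) mod 11)) = ?K (10 - j)"
    if "j \<in> {..<11}" for j
  proof -
    have j: "j \<in> set [0..<11]" using that by (simp only: set_upt atLeastLessThan_iff lessThan_iff le0 simp_thms)
    have "\<forall>j\<in>set [0..<11]. (11 - j) mod 11 = (10 - j + 1) mod 11 \<and> (11 - (j + 1) mod 11) mod 11 = 10 - j"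
      by code_simp
    note ends = this[THEN bspec, OF j]
    have "\<forall>j\<in>set [0..<11]. (11 - (j + 11 - 2) mod 11) mod 11 = (10 - j + 11 - 8) mod 11 \<and>
        (11 - (j + 11 - 4) mod 11) mod 11 = (10 - j + 11 - 6) mod 11 \<and>
        (11 - (j + 11 - 6) mod 11) mod 11 = (10 - j + 11 - 4) mod 11"
      by code_simp
    note tails = this[THEN bspec, OF j]
    from assms consider "a = 6" "b = 8" "c = 2" "d = 4" | "a = 4" "b = 8" "c = 2" "d = 6" by auto
    then have "kfe_edges (?r j) (?r ((j + 1) mod 11)) (?r ((j + 11 - c) mod 11)) (?r ((j + 11 - d) mod 11)) =
        kfe_edges (h ((10 - j + 1) mod 11)) (h (10 - j)) (h ((10 - j + 11 - b) mod 11)) (h ((10 - j + 11 - a) mod 11))"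
      by cases (simp_all only: ends tails)
    then show ?thesis by (simp only: kfe_edges_swap)
  qed
  then have "image_design ?r (cyclic_design c d) = (\<lambda>j. ?K (10 - j)) ` {..<11}"
    unfolding image_cyclic_design by (intro image_cong refl)
  also have "\<dots> = ?K ` ((\<lambda>j. 10 - j) ` {..<11})" by (simp add: image_image)
  also have "(\<lambda>j. 10 - j) ` {..<11} = {..<11::nat}"
  proof -
    have "x \<in> (\<lambda>j. 10 - j) ` {..<11}" if "x < 11" for x :: nat
      using imageI[of "10 - x" "{..<11}" "\<lambda>j. 10 - j"] that by simp
    then show ?thesis by auto
  qed
  finally show ?thesis by (simp only: image_cyclic_design)
qed

text \<open>The search tells of which spines each vertex is a tail; \<open>tail_eq\<close> turns
  this into the tails of each spine, and a block is determined by its spine and tails.\<close>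

lemma kfe_design_is_cyclic:
  fixes X :: "'a set"
  assumes fin: "finite X" and card_X: "card X = 11" and des: "kfe_design X B"
  obtains h :: "nat \<Rightarrow> 'a" and a b :: nat where "bij_betw h {..<11} X" "(a, b) \<in> {(2,4),(2,6),(6,8),(4,8)}"
    "B = image_design h (cyclic_design a b)"
proof -
  note A = fin card_X des
  interpret spine_tournament X "nbrs B" "tailed B"
    by unfold_locales (use A nbrs_basic[OF A] card_nbrs[OF A] tailed_shape[OF A] tailed_tournament[OF A] in auto)
  obtain h :: "nat \<Rightarrow> 'a" and a b :: nat where h: "bij_betw h {..<11} X" and ab: "(a, b) \<in> {(2,4),(2,6),(6,8),(4,8)}"
    and next_nbr: "\<And>i. i < 11 \<Longrightarrow> h ((i + 1) mod 11) \<in> nbrs B (h i)"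
    and nbr: "\<And>x y. y \<in> nbrs B x \<Longrightarrow> \<exists>i<11. {x,y} = h ` {i, (i + 1) mod 11}"
    and T: "\<And>y. y < 11 \<Longrightarrow> tailed B (h y) =
      {h ` {(y + a) mod 11, ((y + a) mod 11 + 1) mod 11}, h ` {(y + b) mod 11, ((y + b) mod 11 + 1) mod 11}}"
    by (rule rotational_labelling) (rule that, assumption+)
  have inj: "inj_on h {..<11}" using h by (rule bij_betw_imp_inj_on)
  define e where "e i = h ` {i, (i + 1) mod 11}" for i
  have e_inj: "e i = e j \<longleftrightarrow> i = j" if "i < 11" "j < 11" for i j
  proof
    assume "e i = e j"
    moreover have "{i, (i + 1) mod 11} \<subseteq> {..<11}" "{j, (j + 1) mod 11} \<subseteq> {..<11}" using that by auto
    ultimately have "{i, (i + 1) mod 11} = {j, (j + 1) mod 11}"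
      unfolding e_def using inj_on_image_eq_iff[OF inj] by blast
    then show "i = j" using that by (auto simp: doubleton_eq_iff mod_Suc split: if_splits)
  qed simp
  define K where "K j = kfe_edges (h j) (h ((j + 1) mod 11)) (h ((j + 11 - a) mod 11)) (h ((j + 11 - b) mod 11))" for j
  have block: "E = K j" if E: "E \<in> B" "spine E = e j" and j: "j < 11" for E j
  proof -
    have "e j \<in> tailed B (h y) \<longleftrightarrow> y = (j + 11 - a) mod 11 \<or> y = (j + 11 - b) mod 11" if y: "y < 11" for y
    proof -
      have "e j \<in> tailed B (h y) \<longleftrightarrow> j = (y + a) mod 11 \<or> j = (y + b) mod 11"
        using T[OF y] e_inj[OF j, of "(y + a) mod 11"] e_inj[OF j, of "(y + b) mod 11"] by (simp add: e_def)
      \<comment> \<open>Turns the offsets seen from a tail into the offsets seen from a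
        spine.\<close>
      moreover have "j = (y + c) mod 11 \<longleftrightarrow> y = (j + 11 - c) mod 11" if "c < 11" for c
        using that j y by (auto simp: mod_if)
      moreover have "a < 11" "b < 11" using ab by auto
      ultimately show ?thesis by blast
    qed
    moreover define p q where "p = (j + 11 - a) mod 11" and "q = (j + 11 - b) mod 11"
    ultimately have "{y \<in> {..<11}. e j \<in> tailed B (h y)} = {p, q}" by auto
    moreover have "tail E = h ` {y \<in> {..<11}. e j \<in> tailed B (h y)}"
      using tail_eq[OF A E(1)] E(2) bij_betw_imp_surj_on[OF h] by auto
    ultimately have tail: "tail E = {h p, h q}" by simp
    obtain s t u v where stuv: "E = kfe_edges s t u v" "spine E = {s,t}" "tail E = {u,v}"
      using kfe_blockE[OF block_of_design[OF A E(1)]] by metis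
    have "kfe_edges s t u v = kfe_edges (h j) (h ((j + 1) mod 11)) (h p) (h q)"
      by (rule kfe_edges_cong) (use stuv E(2) tail in \<open>simp_all add: e_def\<close>)
    then show ?thesis unfolding K_def stuv(1) p_def q_def .
  qed
  have spine_nbrs: "\<exists>E\<in>B. spine E = {x,y}" if "y \<in> nbrs B x" for x y
    using that by (auto simp: nbrs_def[OF A])
  \<comment> \<open>Every block has some \<open>e i\<close> as spine, and conversely every
    \<open>e j\<close> is the spine of a block, because consecutive labels are neighbours.\<close>
  have "B = K ` {..<11}"
  proof (intro subset_antisym subsetI)
    fix E assume E: "E \<in> B"
    obtain x where "x \<in> spine E" using spine_tail(1)[OF A E] by fastforce
    then obtain y where "spine E = {x,y}" "y \<noteq> x" using spine_pair[OF A E] by metis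
    then have "y \<in> nbrs B x" using nbrs_iff[OF A, of x y] E by auto
    then obtain i where "i < 11" "spine E = e i" using nbr \<open>spine E = {x,y}\<close> unfolding e_def by metis
    then show "E \<in> K ` {..<11}" using block[OF E] by blast
  next
    fix E assume "E \<in> K ` {..<11}"
    then obtain j where j: "j < 11" "E = K j" by auto
    obtain F where "F \<in> B" "spine F = e j" using spine_nbrs[OF next_nbr[OF j(1)]] by (auto simp: e_def)
    then show "E \<in> B" using block j by metis
  qed
  then have "B = image_design h (cyclic_design a b)" unfolding image_cyclic_design K_def .
  then show thesis by (rule that[OF h ab])
qed

lemma bij_betw_reflect: "bij_betw (\<lambda>i. (11 - i) mod 11) {..<11} {..<11::nat}"
  by (rule bij_betw_byWitness[where f' = "\<lambda>i. (11 - i) mod 11"]) (auto simp: mod_if)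

theorem theorem3p3:
  fixes X :: "'a set"
  assumes "finite X" and "card X = 11"
  shows "\<exists>\<B>1 \<B>2. kfe_design X \<B>1 \<and> kfe_design X \<B>2 \<and> \<not> kfe_iso X \<B>1 \<B>2 \<and>
           (\<forall>\<B>. kfe_design X \<B> \<longrightarrow> kfe_iso X \<B> \<B>1 \<or> kfe_iso X \<B> \<B>2)"
proof -
  obtain g :: "nat \<Rightarrow> 'a" where g: "bij_betw g {..<11} X"
    using ex_bij_betw_nat_finite[OF assms(1)] assms(2) by (auto simp: atLeast0LessThan)
  \<comment> \<open>The representatives live on one fixed numbering \<open>g\<close>; each design
    brings its own numbering, and \<open>kfe_iso_images\<close> compares the two.\<close>
  let ?B = "\<lambda>b. image_design g (cyclic_design 2 b)"
  have "kfe_iso X B (?B 4) \<or> kfe_iso X B (?B 6)" if "kfe_design X B" for B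
  proof -
    obtain h :: "nat \<Rightarrow> 'a" and a b :: nat where h: "bij_betw h {..<11} X" and ab: "(a, b) \<in> {(2,4),(2,6),(6,8),(4,8)}"
      and B: "B = image_design h (cyclic_design a b)"
      using kfe_design_is_cyclic[OF assms \<open>kfe_design X B\<close>] by metis
    have "\<exists>k c. bij_betw k {..<11} X \<and> c \<in> {4, 6} \<and> B = image_design k (cyclic_design 2 c)"
    proof (cases "a = 2")
      case True
      then show ?thesis using h ab B by auto
    next
      case False
      \<comment> \<open>Here \<open>b\<close> is 8 and \<open>a\<close> is 6 or 4, so reflection
        yields the offsets 2 and 10 - a.\<close>
      then have "(a, b, 2, if a = 6 then 4 else 6) \<in> {(6, 8, 2, 4), (4, 8, 2, 6::nat)}" using ab by auto
      from reflect_cyclic[OF this, of h]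
      have "B = image_design (\<lambda>i. h ((11 - i) mod 11)) (cyclic_design 2 (if a = 6 then 4 else 6))"
        by (simp only: B)
      moreover have "bij_betw (\<lambda>i. h ((11 - i) mod 11)) {..<11} X"
        using bij_betw_trans[OF bij_betw_reflect h] by (simp add: comp_def)
      ultimately show ?thesis by (intro exI conjI) auto
    qed
    then obtain k c where k: "bij_betw k {..<11} X" "c = 4 \<or> c = 6" "B = image_design k (cyclic_design 2 c)" by auto
    then have "kfe_iso X B (?B c)" using kfe_iso_images[OF k(1) g kfe_design_cyclic[of 2 c]] by auto
    then show ?thesis using k(2) by auto
  qed
  moreover have "kfe_design X (?B 4)" "kfe_design X (?B 6)"
    using kfe_design_image[OF g kfe_design_cyclic] by auto
  ultimately show ?thesis using not_iso_cyclic[OF g] by blast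
qed

end
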